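(* Suppose $\Omega \subseteq \mathcal{X}\times\mathbb{R}^m$ has the constraint satisfaction property (a) and the disturbance invariance property (b) stated in the context. Let $x_0\in\mathcal{X}$ and suppose there is a feasible point $\mathcal{M}_0$ of the LBMPC problem at time $0$ with initial state $x_0$. Consider the closed-loop system $x_{n+1}=Ax_n+Bu_n+g(x_n,u_n)$, $u_n=Kx_n+c_n[\mathcal{M}_n^*]$, where $\mathcal{M}_n^*$ is a minimizing point of the LBMPC problem at time $n$ with state $x_n$. Then, for all times $n\ge 0$, the closed-loop system (a) is stable (its states remain within a bounded set), (b) satisfies all state and input constraints, i.e. $x_n\in\mathcal{X}$ and $u_n\in\mathcal{U}$, and (c) is feasible, i.e. the LBMPC problem at time $n$ with state $x_n$ has a feasible point.
   Context: Polytopes are convex and compact. Minkowski sum: $\mathcal{S}\oplus\mathcal{T}=\{s+t: s\in\mathcal{S}, t\in\mathcal{T}\}$. Pontryagin difference: $\mathcal{S}\ominus\mathcal{T}=\{s: \{s\}\oplus\mathcal{T}\subseteq\mathcal{S}\}$. For a matrix $T$, $T\mathcal{S}=\{Ts: s\in\mathcal{S}\}$. True system: $x_{n+1}=Ax_n+Bu_n+g(x_n,u_n)$ with $x_n\in\mathbb{R}^p$, $u_n\in\mathbb{R}^m$; $\mathcal{X}\subset\mathbb{R}^p$, $\mathcal{U}\subset\mathbb{R}^m$ and $\mathcal{W}\subset\mathbb{R}^p$ are polytopes, $\mathcal{X}$ and $\mathcal{U}$ are the state and input constraint sets, and $g(x,u)\in\mathcal{W}$ for all $(x,u)\in\mathcal{X}\times\mathcal{U}$.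 The pair $(A,B)$ is stabilizable, and $K$ is a gain such that $A+BK$ is Schur stable (all eigenvalues of magnitude strictly less than one). $\Lambda\in\mathbb{R}^{p\times m}$, $\Psi\in\mathbb{R}^{m\times m}$ are full column-rank matrices parametrizing the steady states $\overline{x}_s=\Lambda\theta$, $\overline{u}_s=\Psi\theta$, $\theta\in\mathbb{R}^m$, i.e. $\mathrm{range}([\Lambda'\ \Psi']')=\mathrm{null}([(\mathbb{I}-A)\ \ -B])$, where $'$ denotes transpose. Properties of $\Omega\subseteq\mathcal{X}\times\mathbb{R}^m$: (a) constraint satisfaction: $\Omega\subseteq\{(\overline{x},\theta): \overline{x}\in\mathcal{X};\ \Lambda\theta\in\mathcal{X};\ K\overline{x}+(\Psi-K\Lambda)\theta\in\mathcal{U};\ \Psi\theta\in\mathcal{U}\}$; (b) disturbance invariance: $\begin{bmatrix}A+BK & B(\Psi-K\Lambda)\\ 0&\mathbb{I}\end{bmatrix}\Omega\oplus(\mathcal{W}\times\{0\})\subseteq\Omega$. Let $N\ge 1$ be the horizon, $\mathcal{I}=\{0,\ldots,N-1\}$, $\mathcal{R}_0=\{0\}$, $\mathcal{R}_i=\bigoplus_{j=0}^{i-1}(A+BK)^j\mathcal{W}$. For each $n$, the oracle $\mathcal{O}_n:\mathbb{R}^p\times\mathbb{R}^m\to\mathbb{R}^p$ is an arbitrary function and $\psi_n$ is a non-negative cost that is Lipschitz continuous in its arguments (over the bounded ranges of states and inputs, so that e.g. linear and quadratic costs are admitted). LBMPC problem at time $n$ with state $x_n$: minimize over $c=(c_n,\ldots,c_{n+N-1})$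 with $c_{n+i}\in\mathbb{R}^m$, and $\theta\in\mathbb{R}^m$, the cost $$\psi_n(\theta,\tilde{x}_n,\ldots,\tilde{x}_{n+N},\check{u}_n,\ldots,\check{u}_{n+N-1})$$ subject to $\tilde{x}_n=x_n$, $\overline{x}_n=x_n$, and for all $i\in\mathcal{I}$: $\tilde{x}_{n+i+1}=A\tilde{x}_{n+i}+B\check{u}_{n+i}+\mathcal{O}_n(\tilde{x}_{n+i},\check{u}_{n+i})$; $\overline{x}_{n+i+1}=A\overline{x}_{n+i}+B\check{u}_{n+i}$; $\check{u}_{n+i}=K\overline{x}_{n+i}+c_{n+i}$; $\overline{x}_{n+i+1}\in\mathcal{X}\ominus\mathcal{R}_{i+1}$; $\check{u}_{n+i}\in\mathcal{U}\ominus K\mathcal{R}_i$; and $(\overline{x}_{n+N},\theta)\in\Omega\ominus(\mathcal{R}_N\times\{0\})$. A feasible point is a pair $\mathcal{M}_n=(c,\theta)$ satisfying all constraints; $c_n[\mathcal{M}_n]$ denotes its first component $c_n$. It is understood that the minimum is attained whenever the problem is feasible, so that the control law is defined. *)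

theory Defs
  imports "HOL-Analysis.Analysis"
begin

text \<open>
  The Minkowski sum is the set addition of \<^theory>\<open>HOL-Library.Set_Algebras\<close>; with it, sets form a
  commutative monoid with unit \<open>{0}\<close>, so \<open>\<Sum>\<close> denotes finite Minkowski sums.
\<close>

definition pontryagin_diff :: "'a::plus set \<Rightarrow> 'a set \<Rightarrow> 'a set"  (infixl \<open>\<ominus>\<close> 65)
  where "S \<ominus> T = {s. {s} + T \<subseteq> S}"

text \<open>Eigenvalues of a real matrix are taken over the complex numbers.\<close>

definition eigenvalue_of :: "real^'n^'n \<Rightarrow> complex \<Rightarrow> bool"
  where "eigenvalue_of M \<mu> \<longleftrightarrow> (\<exists>v. v \<noteq> 0 \<and> map_matrix complex_of_real M *v v = \<mu> *s v)"

definition schur_stable :: "real^'n^'n \<Rightarrow> bool"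
  where "schur_stable M \<longleftrightarrow> (\<forall>\<mu>. eigenvalue_of M \<mu> \<longrightarrow> cmod \<mu> < 1)"

definition stabilizable :: "real^'p^'p \<Rightarrow> real^'m^'p \<Rightarrow> bool"
  where "stabilizable A B \<longleftrightarrow> (\<exists>K. schur_stable (A + B ** K))"

definition steady_state_parametrization ::
    "real^'p^'p \<Rightarrow> real^'m^'p \<Rightarrow> real^'m^'p \<Rightarrow> real^'m^'m \<Rightarrow> bool"
  where "steady_state_parametrization A B \<Lambda> \<Psi> \<longleftrightarrow>
    rank \<Lambda> = CARD('m) \<and> rank \<Psi> = CARD('m) \<and>
    range (\<lambda>\<theta>. (\<Lambda> *v \<theta>, \<Psi> *v \<theta>)) = {(x, u). (mat 1 - A) *v x - B *v u = 0}"

definition constraint_satisfaction ::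
    "(real^'p) set \<Rightarrow> (real^'m) set \<Rightarrow> real^'p^'m \<Rightarrow> real^'m^'p \<Rightarrow> real^'m^'m \<Rightarrow>
     ((real^'p) \<times> (real^'m)) set \<Rightarrow> bool"
  where "constraint_satisfaction X U K \<Lambda> \<Psi> \<Omega> \<longleftrightarrow>
    \<Omega> \<subseteq> {(x, \<theta>). x \<in> X \<and> \<Lambda> *v \<theta> \<in> X \<and>
                   K *v x + (\<Psi> - K ** \<Lambda>) *v \<theta> \<in> U \<and> \<Psi> *v \<theta> \<in> U}"

definition disturbance_invariance ::
    "real^'p^'p \<Rightarrow> real^'m^'p \<Rightarrow> real^'p^'m \<Rightarrow> real^'m^'p \<Rightarrow> real^'m^'m \<Rightarrow>
     (real^'p) set \<Rightarrow> ((real^'p) \<times> (real^'m)) set \<Rightarrow> bool"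
  where "disturbance_invariance A B K \<Lambda> \<Psi> W \<Omega> \<longleftrightarrow>
    (\<lambda>(x, \<theta>). ((A + B ** K) *v x + (B ** (\<Psi> - K ** \<Lambda>)) *v \<theta>, \<theta>)) ` \<Omega> + W \<times> {0} \<subseteq> \<Omega>"

definition reach_set :: "real^'p^'p \<Rightarrow> real^'m^'p \<Rightarrow> real^'p^'m \<Rightarrow> (real^'p) set \<Rightarrow> nat \<Rightarrow> (real^'p) set"
  where "reach_set A B K W i = (\<Sum>j<i. (((*v) (A + B ** K)) ^^ j) ` W)"

text \<open>
  Predicted trajectories over the horizon, started in \<open>x\<close> and driven by the list \<open>c\<close> of input
  offsets. The offset \<open>c ! i\<close> and the values at \<open>i\<close> belong to the absolute time \<open>n + i\<close>. Both
  trajectories are driven by the same input, whose feedback acts on the nominal state.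
\<close>

primrec nominal_state ::
    "real^'p^'p \<Rightarrow> real^'m^'p \<Rightarrow> real^'p^'m \<Rightarrow> real^'p \<Rightarrow> (real^'m) list \<Rightarrow> nat \<Rightarrow> real^'p"
  where
    "nominal_state A B K x c 0 = x"
  | "nominal_state A B K x c (Suc i) =
       A *v nominal_state A B K x c i + B *v (K *v nominal_state A B K x c i + c ! i)"

definition predicted_input ::
    "real^'p^'p \<Rightarrow> real^'m^'p \<Rightarrow> real^'p^'m \<Rightarrow> real^'p \<Rightarrow> (real^'m) list \<Rightarrow> nat \<Rightarrow> real^'m"
  where "predicted_input A B K x c i = K *v nominal_state A B K x c i + c ! i"

primrec learned_state ::
    "real^'p^'p \<Rightarrow> real^'m^'p \<Rightarrow> real^'p^'m \<Rightarrow> (real^'p \<Rightarrow> real^'m \<Rightarrow> real^'p) \<Rightarrow>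
     real^'p \<Rightarrow> (real^'m) list \<Rightarrow> nat \<Rightarrow> real^'p"
  where
    "learned_state A B K Or x c 0 = x"
  | "learned_state A B K Or x c (Suc i) =
       A *v learned_state A B K Or x c i + B *v predicted_input A B K x c i
       + Or (learned_state A B K Or x c i) (predicted_input A B K x c i)"

definition lbmpc_feasible ::
    "real^'p^'p \<Rightarrow> real^'m^'p \<Rightarrow> real^'p^'m \<Rightarrow> (real^'p) set \<Rightarrow> (real^'m) set \<Rightarrow> (real^'p) set \<Rightarrow>
     ((real^'p) \<times> (real^'m)) set \<Rightarrow> nat \<Rightarrow> real^'p \<Rightarrow> (real^'m) list \<times> (real^'m) \<Rightarrow> bool"
  where "lbmpc_feasible A B K X U W \<Omega> N x = (\<lambda>(c, \<theta>).
    length c = N \<and>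
    (\<forall>i<N. nominal_state A B K x c (Suc i) \<in> X \<ominus> reach_set A B K W (Suc i) \<and>
           predicted_input A B K x c i \<in> U \<ominus> ((*v) K) ` reach_set A B K W i) \<and>
    (nominal_state A B K x c N, \<theta>) \<in> \<Omega> \<ominus> (reach_set A B K W N \<times> {0}))"

text \<open>
  The arguments of a cost function are \<open>\<theta>\<close>, the list of the \<open>N + 1\<close> states and the list of the
  \<open>N\<close> inputs.
\<close>

type_synonym ('p, 'm) cost = "real^'m \<Rightarrow> (real^'p) list \<Rightarrow> (real^'m) list \<Rightarrow> real"

definition nonneg_cost :: "nat \<Rightarrow> ('p::finite, 'm::finite) cost \<Rightarrow> bool"
  where "nonneg_cost N \<psi> \<longleftrightarrow>
    (\<forall>\<theta> xs us. length xs = N + 1 \<longrightarrow> length us = N \<longrightarrow> 0 \<le> \<psi> \<theta> xs us)"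

text \<open>
  Lipschitz continuity, jointly in all arguments, on every bounded range of the arguments; the
  constant may depend on the range, so quadratic costs qualify.
\<close>

definition lipschitz_cost :: "nat \<Rightarrow> ('p::finite, 'm::finite) cost \<Rightarrow> bool"
  where "lipschitz_cost N \<psi> \<longleftrightarrow> (\<forall>r. \<exists>L. \<forall>\<theta> \<theta>' xs xs' us us'.
    length xs = N + 1 \<longrightarrow> length xs' = N + 1 \<longrightarrow> length us = N \<longrightarrow> length us' = N \<longrightarrow>
    {\<theta>, \<theta>'} \<subseteq> cball 0 r \<longrightarrow> set xs \<union> set xs' \<subseteq> cball 0 r \<longrightarrow> set us \<union> set us' \<subseteq> cball 0 r \<longrightarrow>
    dist (\<psi> \<theta> xs us) (\<psi> \<theta>' xs' us')
      \<le> L * (dist \<theta> \<theta>' + (\<Sum>i\<le>N. dist (xs ! i) (xs' ! i)) + (\<Sum>i<N. dist (us ! i) (us' ! i))))"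

definition lbmpc_cost ::
    "real^'p^'p \<Rightarrow> real^'m^'p \<Rightarrow> real^'p^'m \<Rightarrow> nat \<Rightarrow> ('p, 'm) cost \<Rightarrow>
     (real^'p \<Rightarrow> real^'m \<Rightarrow> real^'p) \<Rightarrow> real^'p \<Rightarrow> (real^'m) list \<times> (real^'m) \<Rightarrow> real"
  where "lbmpc_cost A B K N \<psi> Or x = (\<lambda>(c, \<theta>).
    \<psi> \<theta> (map (learned_state A B K Or x c) [0..<N + 1]) (map (predicted_input A B K x c) [0..<N]))"

definition lbmpc_minimizer ::
    "real^'p^'p \<Rightarrow> real^'m^'p \<Rightarrow> real^'p^'m \<Rightarrow> (real^'p) set \<Rightarrow> (real^'m) set \<Rightarrow> (real^'p) set \<Rightarrow>
     ((real^'p) \<times> (real^'m)) set \<Rightarrow> nat \<Rightarrow> ('p, 'm) cost \<Rightarrow> (real^'p \<Rightarrow> real^'m \<Rightarrow> real^'p) \<Rightarrow>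
     real^'p \<Rightarrow> (real^'m) list \<times> (real^'m) \<Rightarrow> bool"
  where "lbmpc_minimizer A B K X U W \<Omega> N \<psi> Or x =
    is_arg_min (lbmpc_cost A B K N \<psi> Or x) (lbmpc_feasible A B K X U W \<Omega> N x)"

definition first_offset :: "(real^'m) list \<times> (real^'m) \<Rightarrow> real^'m"
  where "first_offset M = fst M ! 0"

end

theory Submission
  imports Defs
begin

text \<open>
  Let \<open>(c, \<theta>)\<close> be feasible at \<open>x\<close>, and let the disturbance \<open>w\<close> take the state to \<open>x\<^sub>1 + w\<close>, where
  \<open>x\<^sub>1\<close> is the predicted nominal successor. Dropping the first offset and appending
  \<open>(\<Psi> - K \<Lambda>) \<theta>\<close> gives, with the same \<open>\<theta>\<close>, a feasible point at \<open>x\<^sub>1 + w\<close>: its nominal trajectory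
  is the old one displaced by \<open>(A + B K)\<^sup>i w\<close>, and the reach sets by which the constraints were
  tightened absorb this displacement. The appended step is the terminal control law, for which
  the terminal set \<open>\<Omega>\<close> is invariant. Since the first constraint on the state is tightened by \<open>W\<close>,
  the successor remains in the compact set \<open>X\<close>.
\<close>

lemma pontryagin_diff_iff: "s \<in> S \<ominus> T \<longleftrightarrow> (\<forall>t\<in>T. s + t \<in> S)"
  by (auto simp: pontryagin_diff_def set_plus_def)

text \<open>A displacement \<open>v\<close> is paid for by the summand \<open>V\<close> of the
  tightening, so the tightening by \<open>T\<close> survives.\<close>

lemma pontryagin_diff_plusD:
  fixes S :: "'a::ab_semigroup_add set"
  assumes "s \<in> S \<ominus> (T + V)" and "v \<in> V"
  shows "s + v \<in> S \<ominus> T"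
  unfolding pontryagin_diff_iff
proof
  fix t assume "t \<in> T"
  then have "t + v \<in> T + V" using assms(2) by (rule set_plus_intro)
  then have "s + (t + v) \<in> S" using assms(1) by (simp add: pontryagin_diff_iff)
  then show "s + v + t \<in> S" by (simp add: ac_simps)
qed

lemma image_matrix_vector_mult_plus:
  fixes M :: "'a::semiring_1^'n^'m"
  shows "(*v) M ` (S + T) = (*v) M ` S + (*v) M ` T"
  by (force simp: set_plus_def matrix_vector_right_distrib)

lemma reach_set_0: "reach_set A B K W 0 = {0}"
  by (simp add: reach_set_def set_zero)

lemma reach_set_Suc:
  "reach_set A B K W (Suc i) = reach_set A B K W i + ((*v) (A + B ** K) ^^ i) ` W"
  by (simp add: reach_set_def)

text \<open>The definition splits off the term of highest power; here the fresh disturbance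
  \<open>W\<close> is split off and \<open>A + B ** K\<close> is factored out of the rest. This is
  the form that matches disturbance invariance.\<close>

lemma reach_set_Suc_shift:
  "reach_set A B K W (Suc i) = W + (*v) (A + B ** K) ` reach_set A B K W i"
proof (induction i)
  case 0
  have "(*v) (A + B ** K) ` 0 = 0" by (simp add: set_zero)
  then show ?case by (simp add: reach_set_0 reach_set_Suc flip: set_zero)
next
  case (Suc i)
  have "reach_set A B K W (Suc (Suc i)) =
      W + (*v) (A + B ** K) ` reach_set A B K W i
        + (*v) (A + B ** K) ` ((*v) (A + B ** K) ^^ i) ` W"
    by (simp only: reach_set_Suc[of _ _ _ _ "Suc i"] Suc.IH funpow.simps image_comp)
  also have "\<dots> = W + (*v) (A + B ** K) ` reach_set A B K W (Suc i)"
    by (simp only: reach_set_Suc[of _ _ _ _ i] image_matrix_vector_mult_plus add.assoc)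
  finally show ?case .
qed

lemma nominal_state_Suc:
  "nominal_state A B K x c (Suc i) = (A + B ** K) *v nominal_state A B K x c i + B *v (c ! i)"
  by (simp add: matrix_vector_mult_add_rdistrib matrix_vector_right_distrib
      matrix_vector_mul_assoc add.assoc)

text \<open>Both trajectories use the same offsets, so their difference obeys the linear recursion
  of \<open>A + B ** K\<close> started at \<open>w\<close>. The state at \<open>i\<close> depends
  only on offsets before \<open>i\<close>, so \<open>d\<close> does not enter yet.\<close>

lemma nominal_state_shift:
  assumes "i < length c"
  shows "nominal_state A B K (nominal_state A B K x c 1 + w) (tl c @ [d]) i =
    nominal_state A B K x c (Suc i) + ((*v) (A + B ** K) ^^ i) w"
  using assms
proof (induction i)
  case 0
  show ?case by simp
next
  case (Suc i)
  then have "(tl c @ [d]) ! i = c ! Suc i"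
    by (cases c) (simp_all add: nth_append)
  with Suc show ?case
    by (simp add: nominal_state_Suc matrix_vector_right_distrib del: nominal_state.simps(2))
qed

text \<open>The input at \<open>i\<close> reads offset \<open>i\<close> itself, hence a bound
  stricter by one than for the states.\<close>

lemma predicted_input_shift:
  assumes "Suc i < length c"
  shows "predicted_input A B K (nominal_state A B K x c 1 + w) (tl c @ [d]) i =
    predicted_input A B K x c (Suc i) + K *v ((*v) (A + B ** K) ^^ i) w"
proof -
  have "(tl c @ [d]) ! i = c ! Suc i"
    using assms by (cases c) (simp_all add: nth_append)
  then show ?thesis
    using assms
    by (simp add: predicted_input_def nominal_state_shift matrix_vector_right_distrib
        del: nominal_state.simps(2) One_nat_def)
qed

lemma lbmpc_feasible_step:
  fixes A :: "real^'p^'p" and B :: "real^'m^'p" and \<Psi> :: "real^'m^'m"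
  assumes cs: "constraint_satisfaction X U K \<Lambda> \<Psi> \<Omega>"
    and di: "disturbance_invariance A B K \<Lambda> \<Psi> W \<Omega>"
    and N: "N \<ge> 1"
    and feas: "lbmpc_feasible A B K X U W \<Omega> N x (c, \<theta>)"
    and w: "w \<in> W"
  shows "lbmpc_feasible A B K X U W \<Omega> N (nominal_state A B K x c 1 + w)
    (tl c @ [(\<Psi> - K ** \<Lambda>) *v \<theta>], \<theta>)"
proof -
  let ?\<Phi> = "A + B ** K"
  let ?R = "reach_set A B K W"
  define x' where "x' = nominal_state A B K x c 1 + w"
  define d where "d = (\<Psi> - K ** \<Lambda>) *v \<theta>"
  define c' where "c' = tl c @ [d]"
  let ?z = "nominal_state A B K x c" and ?v = "predicted_input A B K x c"
  let ?z' = "nominal_state A B K x' c'" and ?v' = "predicted_input A B K x' c'"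
  obtain m where m: "N = Suc m" using N by (cases N) auto
  from feas have len: "length c = N"
    and zX: "\<And>i. i < N \<Longrightarrow> ?z (Suc i) \<in> X \<ominus> ?R (Suc i)"
    and vU: "\<And>i. i < N \<Longrightarrow> ?v i \<in> U \<ominus> (*v) K ` ?R i"
    and term\<Omega>: "(?z N, \<theta>) \<in> \<Omega> \<ominus> (?R N \<times> {0})"
    by (auto simp: lbmpc_feasible_def)
  have z': "?z' i = ?z (Suc i) + ((*v) ?\<Phi> ^^ i) w" if "i < N" for i
    using that len unfolding x'_def c'_def by (intro nominal_state_shift) simp
  \<comment> \<open>With \<open>d\<close> as offset the loop is exactly the terminal dynamics on the
    slice of \<open>\<Omega>\<close> at \<open>\<theta>\<close>.\<close>
  have \<Omega>D: "K *v y + d \<in> U" "?\<Phi> *v y + B *v d + e \<in> X"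
      "(?\<Phi> *v y + B *v d + e, \<theta>) \<in> \<Omega>"
    if y: "(y, \<theta>) \<in> \<Omega>" and e: "e \<in> W" for y e
  proof -
    show "K *v y + d \<in> U"
      using cs y by (auto simp: constraint_satisfaction_def d_def)
    have "(?\<Phi> *v y + B *v d, \<theta>) + (e, 0) \<in> \<Omega>"
      using di unfolding disturbance_invariance_def
    proof (rule subsetD)
      show "(?\<Phi> *v y + B *v d, \<theta>) + (e, 0) \<in>
        (\<lambda>(x, \<theta>). (?\<Phi> *v x + (B ** (\<Psi> - K ** \<Lambda>)) *v \<theta>, \<theta>)) ` \<Omega> + W \<times> {0}"
        using y e by (intro set_plus_intro) (force simp: d_def matrix_vector_mul_assoc)+
    qed
    then show "(?\<Phi> *v y + B *v d + e, \<theta>) \<in> \<Omega>" by simp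
    then show "?\<Phi> *v y + B *v d + e \<in> X"
      using cs by (auto simp: constraint_satisfaction_def)
  qed
  \<comment> \<open>The displacement of \<open>?z' m\<close> from \<open>?z N\<close> is the last
    summand of \<open>?R N\<close>, so the old terminal constraint leaves room for
    \<open>?R m\<close>.\<close>
  have last_\<Omega>: "(?z' m + r, \<theta>) \<in> \<Omega>" if "r \<in> ?R m" for r
  proof -
    have "r + ((*v) ?\<Phi> ^^ m) w \<in> ?R N"
      unfolding m reach_set_Suc using that w by (intro set_plus_intro imageI)
    with term\<Omega> have "(?z N, \<theta>) + (r + ((*v) ?\<Phi> ^^ m) w, 0) \<in> \<Omega>"
      unfolding pontryagin_diff_iff by blast
    then show ?thesis
      using z'[of m] by (simp add: m ac_simps del: nominal_state.simps(2))
  qed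
  have c'_last: "c' ! m = d"
    using len m by (simp add: c'_def nth_append)
  \<comment> \<open>Writing \<open>r = e + ?\<Phi> *v s\<close> turns \<open>?z' N + r\<close> into
    the terminal successor of \<open>?z' m + s\<close> under the disturbance
    \<open>e\<close>.\<close>
  have step: "(?z' N + r, \<theta>) \<in> \<Omega>" "?z' N + r \<in> X" if "r \<in> ?R N" for r
  proof -
    from that obtain e s where e: "e \<in> W" and s: "s \<in> ?R m" and r: "r = e + ?\<Phi> *v s"
      unfolding m reach_set_Suc_shift by (auto elim!: set_plus_elim)
    have "?z' N + r = ?\<Phi> *v (?z' m + s) + B *v d + e"
      by (simp add: m nominal_state_Suc c'_last r matrix_vector_right_distrib ac_simps
          del: nominal_state.simps(2))
    then show "(?z' N + r, \<theta>) \<in> \<Omega>" "?z' N + r \<in> X"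
      using \<Omega>D(2,3)[OF last_\<Omega>[OF s] e] by simp_all
  qed
  have "?z' (Suc i) \<in> X \<ominus> ?R (Suc i)" if "i < N" for i
  proof (cases "i = m")
    case True
    then show ?thesis using step(2) by (simp add: pontryagin_diff_iff m)
  next
    case False
    then have i: "Suc i < N" using that m by simp
    \<comment> \<open>The displacement lies in the last summand of \<open>?R (Suc (Suc i))\<close>;
      removing it leaves \<open>?R (Suc i)\<close>.\<close>
    show ?thesis
      unfolding z'[OF i] using zX[OF i] w
      by (intro pontryagin_diff_plusD[where V = "((*v) ?\<Phi> ^^ Suc i) ` W"] imageI)
        (simp_all only: reach_set_Suc)
  qed
  moreover have "?v' i \<in> U \<ominus> (*v) K ` ?R i" if "i < N" for i
  proof (cases "i = m")
    case True
    have "K *v (?z' m + r) + d \<in> U" if "r \<in> ?R m" for r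
      using \<Omega>D(1)[OF last_\<Omega>[OF that] w] .
    then show ?thesis
      by (auto simp: True pontryagin_diff_iff predicted_input_def c'_last
          matrix_vector_right_distrib ac_simps)
  next
    case False
    then have i: "Suc i < N" using that m by simp
    have "?v' i = ?v (Suc i) + K *v ((*v) ?\<Phi> ^^ i) w"
      using i len unfolding x'_def c'_def by (intro predicted_input_shift) simp
    then show ?thesis
      using pontryagin_diff_plusD[of "?v (Suc i)" U "(*v) K ` ?R i"
          "(*v) K ` ((*v) ?\<Phi> ^^ i) ` W" "K *v ((*v) ?\<Phi> ^^ i) w"] vU[OF i] w
      by (simp add: reach_set_Suc image_matrix_vector_mult_plus)
  qed
  moreover have "(?z' N, \<theta>) \<in> \<Omega> \<ominus> (?R N \<times> {0})"
    using step(1) by (auto simp: pontryagin_diff_iff)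
  moreover have "length c' = N"
    using len m by (simp add: c'_def)
  ultimately show ?thesis
    unfolding lbmpc_feasible_def x'_def[symmetric] d_def[symmetric] c'_def[symmetric] by simp
qed

text \<open>The reach set is \<open>{0}\<close> at index 0 and \<open>W\<close> at index 1: the
  first input is constrained without tightening, and the first successor tolerates any
  disturbance.\<close>

lemma lbmpc_feasible_first_step:
  assumes "N \<ge> 1" and "lbmpc_feasible A B K X U W \<Omega> N x (c, \<theta>)"
  shows "K *v x + c ! 0 \<in> U"
    and "w \<in> W \<Longrightarrow> nominal_state A B K x c 1 + w \<in> X"
proof -
  have "predicted_input A B K x c 0 \<in> U \<ominus> (*v) K ` reach_set A B K W 0"
    and *: "nominal_state A B K x c 1 \<in> X \<ominus> reach_set A B K W 1"
    using assms by (auto simp: lbmpc_feasible_def simp del: nominal_state.simps)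
  then show "K *v x + c ! 0 \<in> U"
    by (simp add: pontryagin_diff_iff reach_set_0 predicted_input_def)
  show "nominal_state A B K x c 1 + w \<in> X" if "w \<in> W"
    using * that by (simp add: pontryagin_diff_iff reach_set_def del: nominal_state.simps)
qed

theorem corollary1:
  fixes A :: "real^'p^'p" and B :: "real^'m^'p" and K :: "real^'p^'m"
    and \<Lambda> :: "real^'m^'p" and \<Psi> :: "real^'m^'m"
    and X :: "(real^'p) set" and U :: "(real^'m) set" and W :: "(real^'p) set"
    and \<Omega> :: "((real^'p) \<times> (real^'m)) set"
    and g :: "real^'p \<Rightarrow> real^'m \<Rightarrow> real^'p"
    and N :: nat
    and Or :: "nat \<Rightarrow> real^'p \<Rightarrow> real^'m \<Rightarrow> real^'p"
    and \<psi> :: "nat \<Rightarrow> ('p, 'm) cost"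
    and x :: "nat \<Rightarrow> real^'p" and u :: "nat \<Rightarrow> real^'m"
    and M0 :: "(real^'m) list \<times> (real^'m)" and Mopt :: "nat \<Rightarrow> (real^'m) list \<times> (real^'m)"
  assumes "polytope X" and "polytope U" and "polytope W"
    and "\<forall>y\<in>X. \<forall>v\<in>U. g y v \<in> W"
    and "stabilizable A B"
    and "schur_stable (A + B ** K)"
    and "steady_state_parametrization A B \<Lambda> \<Psi>"
    and "N \<ge> 1"
    and "\<forall>n. nonneg_cost N (\<psi> n) \<and> lipschitz_cost N (\<psi> n)"
    and minimum_attained:
      "\<forall>n y. (\<exists>M. lbmpc_feasible A B K X U W \<Omega> N y M) \<longrightarrow>
             (\<exists>M. lbmpc_minimizer A B K X U W \<Omega> N (\<psi> n) (Or n) y M)"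
    and "\<Omega> \<subseteq> X \<times> UNIV"
    and "constraint_satisfaction X U K \<Lambda> \<Psi> \<Omega>"
    and "disturbance_invariance A B K \<Lambda> \<Psi> W \<Omega>"
    and "x 0 \<in> X"
    and "lbmpc_feasible A B K X U W \<Omega> N (x 0) M0"
    and closed_loop_state: "\<forall>n. x (Suc n) = A *v x n + B *v u n + g (x n) (u n)"
    and closed_loop_input: "\<forall>n. u n = K *v x n + first_offset (Mopt n)"
    \<comment> \<open>Only where the problem is feasible is \<open>Mopt n\<close> required to be a minimizer, so that
        feasibility for \<open>n > 0\<close> is not assumed.\<close>
    and closed_loop_optimal:
      "\<forall>n. (\<exists>M. lbmpc_feasible A B K X U W \<Omega> N (x n) M) \<longrightarrow>
           lbmpc_minimizer A B K X U W \<Omega> N (\<psi> n) (Or n) (x n) (Mopt n)"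
  shows "bounded (range x) \<and>
    (\<forall>n. x n \<in> X \<and> u n \<in> U) \<and>
    (\<forall>n. \<exists>M. lbmpc_feasible A B K X U W \<Omega> N (x n) M)"
proof -
  have opt: "lbmpc_feasible A B K X U W \<Omega> N (x n) (Mopt n)"
    if "\<exists>M. lbmpc_feasible A B K X U W \<Omega> N (x n) M" for n
    using closed_loop_optimal that by (auto simp: lbmpc_minimizer_def is_arg_min_def)
  have input: "u n \<in> U" if "\<exists>M. lbmpc_feasible A B K X U W \<Omega> N (x n) M" for n
    using lbmpc_feasible_first_step(1)[OF \<open>N \<ge> 1\<close>, of A B K X U W \<Omega> "x n" "fst (Mopt n)"
        "snd (Mopt n)"] opt[OF that] closed_loop_input
    by (simp add: first_offset_def)
  \<comment> \<open>Both claims go through one induction: the problem constrains states only from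
    index 1 on, yet \<open>x n \<in> X\<close> is needed to place \<open>g (x n) (u n)\<close> in
    \<open>W\<close>.\<close>
  have inv: "x n \<in> X \<and> (\<exists>M. lbmpc_feasible A B K X U W \<Omega> N (x n) M)" for n
  proof (induction n)
    case 0
    show ?case using assms by blast
  next
    case (Suc n)
    obtain c \<theta> where M: "Mopt n = (c, \<theta>)" by fastforce
    have feas: "lbmpc_feasible A B K X U W \<Omega> N (x n) (c, \<theta>)"
      using opt Suc.IH M by metis
    have w: "g (x n) (u n) \<in> W"
      using Suc.IH input \<open>\<forall>y\<in>X. \<forall>v\<in>U. g y v \<in> W\<close> by blast
    \<comment> \<open>The nominal trajectory starts at the true state, so its first input is the
      applied one and only \<open>g\<close> separates the successors.\<close>
    have "x (Suc n) = nominal_state A B K (x n) c 1 + g (x n) (u n)"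
      using closed_loop_state closed_loop_input by (simp add: M first_offset_def)
    then show ?case
      using lbmpc_feasible_first_step(2)[OF \<open>N \<ge> 1\<close> feas w]
        lbmpc_feasible_step[OF \<open>constraint_satisfaction X U K \<Lambda> \<Psi> \<Omega>\<close>
          \<open>disturbance_invariance A B K \<Lambda> \<Psi> W \<Omega>\<close> \<open>N \<ge> 1\<close> feas w] by auto
  qed
  then have "range x \<subseteq> X" by blast
  then have "bounded (range x)"
    using \<open>polytope X\<close> polytope_imp_bounded bounded_subset by blast
  then show ?thesis using inv input by blast
qed

end
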